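(* Let $T_b$ be a binary tree and let $T_1=\tau_1(T_b)$. Then the string consisting of one open parenthesis followed by Zaks' sequence of $T_b$ is equal to the BP sequence of $T_1$.
   Context: Zaks' sequence of a binary tree $T_b$ with $n$ nodes: extend $T_b$ by adding an external node wherever a child is missing; label every original (internal) node with an open parenthesis and every external node with a close parenthesis; traverse the extended tree in preorder and output the labels of visited nodes (a string of length $2n+1$). Transformation $\tau_1$: $T_1$ is an ordinal tree (rooted, ordered children) with $n+1$ nodes, namely a dummy root and a node $v(u)$ for each node $u$ of $T_b$. The children of the dummy root are, in order, $v(x_0),\dots,v(x_k)$ where $x_0$ is the root of $T_b$ and $x_{j+1}$ is the right child of $x_j$, up to the last one having no right child. For each node $u$ of $T_b$, the left child of $u$ corresponds to the first child of $v(u)$ and the right child of $u$ corresponds to the next sibling of $v(u)$. BP sequence of an ordinal tree: in a depth-first traversal (children left to right), write an open parenthesis when a node is first visited and a close parenthesis immediately after all of its descendants have been visited. *)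

theory Defs
  imports "HOL-Library.Tree"
begin

datatype paren = Open | Close

text \<open>The library type \<open>'a tree\<close> is the type of binary trees; a \<open>Leaf\<close> is a missing child.
  In the extended tree an original node keeps its identity as \<open>Some a\<close>, and every missing
  child (for the empty tree: the missing root) becomes a childless external node \<open>None\<close>.\<close>

fun extend :: "'a tree \<Rightarrow> 'a option tree" where
  "extend Leaf = Node Leaf None Leaf"
| "extend (Node l a r) = Node (extend l) (Some a) (extend r)"

definition zaks_label :: "'a option \<Rightarrow> paren" where
  "zaks_label x = (case x of Some _ \<Rightarrow> Open | None \<Rightarrow> Close)"

definition zaks :: "'a tree \<Rightarrow> paren list" where
  "zaks t = map zaks_label (preorder (extend t))"

datatype 'a otree = ONode (oroot: 'a) (ochildren: "'a otree list")

fun bp :: "'a otree \<Rightarrow> paren list" where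
  "bp (ONode a ts) = Open # concat (map bp ts) @ [Close]"

text \<open>\<open>sibs t\<close> lists, together with the subtrees below them, \<open>v(u)\<close> for the root \<open>u\<close> of \<open>t\<close>
  and then all its later siblings: the left child of \<open>u\<close> starts the list of children of \<open>v(u)\<close>,
  and the right child of \<open>u\<close> is the next entry of the list. The node \<open>v(u)\<close> is \<open>Some a\<close>, where
  \<open>a\<close> is the entry at \<open>u\<close>, and the dummy root is \<open>None\<close>.\<close>

fun sibs :: "'a tree \<Rightarrow> 'a option otree list" where
  "sibs Leaf = []"
| "sibs (Node l a r) = ONode (Some a) (sibs l) # sibs r"

definition tau1 :: "'a tree \<Rightarrow> 'a option otree" where
  "tau1 t = ONode None (sibs t)"

text \<open>Consistency checks: sizes, and the children of the dummy root in terms of the chain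
  \<open>x\<^sub>0, \<dots>, x\<^sub>k\<close> of right children.\<close>

lemma length_zaks: "length (zaks t) = 2 * size t + 1"
  unfolding zaks_def by (induction t) auto

fun onodes :: "'a otree \<Rightarrow> 'a list" where
  "onodes (ONode a ts) = a # concat (map onodes ts)"

lemma onodes_tau1: "onodes (tau1 t) = None # map Some (preorder t)"
proof -
  have "concat (map onodes (sibs t)) = map Some (preorder t)"
    by (induction t) auto
  then show ?thesis by (simp add: tau1_def)
qed

lemma length_onodes_tau1: "length (onodes (tau1 t)) = size t + 1"
  by (simp add: onodes_tau1)

fun right_spine :: "'a tree \<Rightarrow> 'a tree list" where
  "right_spine Leaf = []"
| "right_spine (Node l a r) = Node l a r # right_spine r"

lemma sibs_right_spine:
  "sibs t = map (\<lambda>x. ONode (Some (value x)) (sibs (left x))) (right_spine t)"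
  by (induction t) auto

lemma ochildren_tau1:
  "map oroot (ochildren (tau1 t)) = map (Some \<circ> value) (right_spine t)"
  unfolding tau1_def sibs_right_spine[of t] by simp

end

theory Submission
  imports Defs
begin

text \<open>A right spine becomes a list of siblings, and the external node ending it supplies the
  \<open>Close\<close> of their parent. So in the induction at \<open>Node l a r\<close>, the final
  \<open>Close\<close> of \<open>zaks l\<close> closes the node \<open>Some a\<close>, while that of
  \<open>zaks r\<close> remains as the extra \<open>Close\<close>. For the whole tree the extra
  \<open>Close\<close> matches the prepended \<open>Open\<close>: together they are the dummy
  root.\<close>

lemma zaks_eq_bp_sibs: "zaks t = concat (map bp (sibs t)) @ [Close]"
  by (induction t) (auto simp: zaks_def zaks_label_def)

theorem theorem4:
  fixes T\<^sub>b :: "'a tree"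
  shows "Open # zaks T\<^sub>b = bp (tau1 T\<^sub>b)"
  by (simp add: tau1_def zaks_eq_bp_sibs)

end
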